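(* Let $(M,+)$ be a commutative unital magma with the cancellation property. Let $f:[0,\infty)\to M$ be injective and let $g:[0,\infty)\to[0,\infty)$. Then $$f(s+g(s)t)=f(s)+f(t)\qquad\text{for all } s,t\in[0,\infty)$$ if and only if one of the following holds: 1. $g(1)=1$, $f$ is additive and $g\equiv 1$; 2. $g(1)\neq 1$ and there are $\alpha\in(0,\infty)$ and an injective additive function $a:[0,\infty)\to M$ such that $$f(s)=a(\log(\alpha s+1))\quad\text{and}\quad g(s)=\alpha s+1\qquad\text{for all } s\in[0,\infty).$$
   Context: A magma $(M,+)$ is a set $M$ with a binary operation $+:M\times M\to M$ (no associativity is assumed). It is unital if there is $\mathbf 0\in M$ with $\mathbf a+\mathbf 0=\mathbf 0+\mathbf a=\mathbf a$ for all $\mathbf a\in M$; commutative if $\mathbf a+\mathbf b=\mathbf b+\mathbf a$ for all $\mathbf a,\mathbf b\in M$; and has the (two-sided) cancellation property if each of $\mathbf a+\mathbf b=\mathbf a+\mathbf c$ and $\mathbf b+\mathbf a=\mathbf c+\mathbf a$ implies $\mathbf b=\mathbf c$. A function $a:[0,\infty)\to M$ is additive if $a(s+t)=a(s)+a(t)$ for all $s,t\in[0,\infty)$. *)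

theory Defs
  imports Complex_Main "HOL-Library.FuncSet"
begin

definition magma :: "'m set \<Rightarrow> ('m \<Rightarrow> 'm \<Rightarrow> 'm) \<Rightarrow> bool" where
  "magma M add \<longleftrightarrow> (\<forall>a\<in>M. \<forall>b\<in>M. add a b \<in> M)"

definition unital :: "'m set \<Rightarrow> ('m \<Rightarrow> 'm \<Rightarrow> 'm) \<Rightarrow> bool" where
  "unital M add \<longleftrightarrow> (\<exists>z\<in>M. \<forall>a\<in>M. add a z = a \<and> add z a = a)"

definition commutative :: "'m set \<Rightarrow> ('m \<Rightarrow> 'm \<Rightarrow> 'm) \<Rightarrow> bool" where
  "commutative M add \<longleftrightarrow> (\<forall>a\<in>M. \<forall>b\<in>M. add a b = add b a)"

definition cancellative :: "'m set \<Rightarrow> ('m \<Rightarrow> 'm \<Rightarrow> 'm) \<Rightarrow> bool" where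
  "cancellative M add \<longleftrightarrow>
     (\<forall>a\<in>M. \<forall>b\<in>M. \<forall>c\<in>M.
        (add a b = add a c \<longrightarrow> b = c) \<and> (add b a = add c a \<longrightarrow> b = c))"

text \<open>A function from \<open>[0, \<infinity>)\<close> to \<open>M\<close> is a function on all reals of which only the
  restriction to \<open>{0..}\<close> is considered; its values at negative reals are arbitrary.\<close>

definition additive_fun :: "'m set \<Rightarrow> ('m \<Rightarrow> 'm \<Rightarrow> 'm) \<Rightarrow> (real \<Rightarrow> 'm) \<Rightarrow> bool" where
  "additive_fun M add a \<longleftrightarrow>
     a \<in> {0..} \<rightarrow> M \<and> (\<forall>s\<in>{0..}. \<forall>t\<in>{0..}. a (s + t) = add (a s) (a t))"

end

theory Submission
  imports Defs
begin

text \<open>By commutativity and injectivity, \<open>s + g s * t = t + g t * s\<close>; at \<open>t = 1\<close> this makes \<open>g\<close>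
  affine with slope \<open>\<alpha> = g 1 - 1\<close>, and \<open>\<alpha> \<ge> 0\<close> because \<open>g \<ge> 0\<close>. If \<open>\<alpha> > 0\<close>, then
  \<open>\<alpha> * (s + g s * t) + 1 = (\<alpha> * s + 1) * (\<alpha> * t + 1)\<close>, so the substitution
  \<open>x = ln (\<alpha> * s + 1)\<close> turns the equation into additivity.\<close>

theorem theorem3p2:
  fixes M :: "'m set"
    and add :: "'m \<Rightarrow> 'm \<Rightarrow> 'm"  (infixl "\<oplus>" 65)
    and f :: "real \<Rightarrow> 'm"
    and g :: "real \<Rightarrow> real"
  assumes "magma M (\<oplus>)" and "unital M (\<oplus>)" and "commutative M (\<oplus>)" and "cancellative M (\<oplus>)"
    and "f \<in> {0..} \<rightarrow> M" and "inj_on f {0..}"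
    and "g \<in> {0..} \<rightarrow> {0..}"
  shows "(\<forall>s\<in>{0..}. \<forall>t\<in>{0..}. f (s + g s * t) = f s \<oplus> f t) \<longleftrightarrow>
    (g 1 = 1 \<and> additive_fun M (\<oplus>) f \<and> (\<forall>s\<in>{0..}. g s = 1)) \<or>
    (g 1 \<noteq> 1 \<and>
      (\<exists>\<alpha>\<in>{0<..}. \<exists>a. additive_fun M (\<oplus>) a \<and> inj_on a {0..} \<and>
        (\<forall>s\<in>{0..}. f s = a (ln (\<alpha> * s + 1)) \<and> g s = \<alpha> * s + 1)))"
    (is "?E \<longleftrightarrow> ?A \<or> ?B")
proof
  assume E: ?E
  define \<alpha> where "\<alpha> = g 1 - 1"
  have g_eq: "g s = \<alpha> * s + 1" if "s \<ge> 0" for s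
  proof -
    have "f (s + g s * 1) = f s \<oplus> f 1" "f (1 + g 1 * s) = f 1 \<oplus> f s"
      using E[rule_format, of s 1] E[rule_format, of 1 s] that by auto
    moreover have "f s \<oplus> f 1 = f 1 \<oplus> f s"
      using assms(3,5) that unfolding commutative_def by (auto simp: Pi_iff)
    ultimately have "f (s + g s * 1) = f (1 + g 1 * s)"
      by simp
    \<comment> \<open>Injectivity of \<open>f\<close> is available only on \<open>{0..}\<close>, so
      both arguments must be placed there before they can be compared.\<close>
    moreover have "s + g s * 1 \<ge> 0" "1 + g 1 * s \<ge> 0"
      using assms(7) that by (auto simp: Pi_iff)
    ultimately have "s + g s * 1 = 1 + g 1 * s"
      using assms(6) by (auto dest: inj_onD)
    then show ?thesis
      by (simp add: \<alpha>_def algebra_simps)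
  qed
  have "\<alpha> \<ge> 0"
  proof (rule ccontr)
    assume neg: "\<not> \<alpha> \<ge> 0"
    \<comment> \<open>For a negative slope, \<open>- 2 / \<alpha>\<close> is the point of the
      half-line at which the affine formula gives \<open>- 1\<close>, a value that \<open>g\<close>
      cannot take.\<close>
    then have "- 2 / \<alpha> \<ge> 0"
      by (simp add: field_simps)
    from g_eq[OF this] have "g (- 2 / \<alpha>) = - 1"
      using neg by simp
    moreover have "g (- 2 / \<alpha>) \<in> {0..}"
      using \<open>- 2 / \<alpha> \<ge> 0\<close> by (intro funcset_mem[OF assms(7)]) simp
    ultimately show False
      by simp
  qed
  show "?A \<or> ?B"
  proof (cases "\<alpha> = 0")
    case True
    then have "g s = 1" if "s \<ge> 0" for s
      using g_eq[OF that] by simp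
    then have ?A
      using E assms(5) by (auto simp: additive_fun_def)
    then show ?thesis ..
  next
    case False
    with \<open>\<alpha> \<ge> 0\<close> have pos: "\<alpha> > 0"
      by simp
    \<comment> \<open>\<open>h\<close> comes from solving \<open>x = ln (\<alpha> * s + 1)\<close>
      for \<open>s\<close>. Hence the required \<open>a\<close> can only be \<open>f\<close>
      composed with \<open>h\<close> on \<open>{0..}\<close>.\<close>
    define h where "h x = (exp x - 1) / \<alpha>" for x
    have h_nonneg: "h x \<ge> 0" if "x \<ge> 0" for x
      using that pos by (simp add: h_def)
    have "f (h (x + y)) = f (h x) \<oplus> f (h y)" if "x \<ge> 0" "y \<ge> 0" for x y
    proof -
      have "g (h x) = exp x"
        using g_eq[OF h_nonneg[OF that(1)]] pos by (simp add: h_def)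
      \<comment> \<open>This is \<open>exp (x + y) - 1 = (exp x - 1) + exp x * (exp y - 1)\<close>
        divided by \<open>\<alpha>\<close>.\<close>
      then have "h (x + y) = h x + g (h x) * h y"
        using pos by (simp add: h_def exp_add field_simps)
      then show ?thesis
        using E[rule_format, of "h x" "h y"] h_nonneg that by simp
    qed
    then have "additive_fun M (\<oplus>) (\<lambda>x. f (h x))"
      using assms(5) h_nonneg by (auto simp: additive_fun_def Pi_iff)
    moreover have "inj_on (\<lambda>x. f (h x)) {0..}"
    proof (rule inj_onI)
      fix x y :: real
      assume "x \<in> {0..}" "y \<in> {0..}" "f (h x) = f (h y)"
      then have "h x = h y"
        using assms(6) h_nonneg by (auto dest: inj_onD)
      then show "x = y"
        using pos by (simp add: h_def)
    qed
    moreover have "f s = f (h (ln (\<alpha> * s + 1))) \<and> g s = \<alpha> * s + 1" if "s \<ge> 0" for s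
    proof -
      \<comment> \<open>Positivity lets \<open>exp\<close> cancel \<open>ln\<close>, so that
        \<open>h\<close> undoes the substitution.\<close>
      have "\<alpha> * s + 1 > 0"
        using pos that by (simp add: add_nonneg_pos)
      then show ?thesis
        using pos g_eq[OF that] by (simp add: h_def)
    qed
    moreover have "g 1 \<noteq> 1"
      using False by (simp add: \<alpha>_def)
    ultimately have ?B
      using pos by (intro conjI bexI[of _ \<alpha>] exI[of _ "\<lambda>x. f (h x)"] ballI) simp_all
    then show ?thesis ..
  qed
next
  assume "?A \<or> ?B"
  then show ?E
  proof
    assume ?A
    then show ?E
      by (auto simp: additive_fun_def)
  next
    assume ?B
    then obtain \<alpha> a where pos: "\<alpha> > 0" and add: "additive_fun M (\<oplus>) a"
      and eq: "\<And>s. s \<ge> 0 \<Longrightarrow> f s = a (ln (\<alpha> * s + 1)) \<and> g s = \<alpha> * s + 1"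
      by auto
    show ?E
    proof (intro ballI)
      fix s t :: real
      assume "s \<in> {0..}" "t \<in> {0..}"
      then have st: "s \<ge> 0" "t \<ge> 0"
        by auto
      have nonneg: "\<alpha> * s \<ge> 0" "\<alpha> * t \<ge> 0"
        using pos st by auto
      then have "s + g s * t \<ge> 0"
        using st eq by simp
      then have "f (s + g s * t) = a (ln (\<alpha> * (s + (\<alpha> * s + 1) * t) + 1))"
        using eq st by simp
      also have "\<alpha> * (s + (\<alpha> * s + 1) * t) + 1 = (\<alpha> * s + 1) * (\<alpha> * t + 1)"
        by (simp add: algebra_simps)
      also have "ln \<dots> = ln (\<alpha> * s + 1) + ln (\<alpha> * t + 1)"
        using nonneg by (intro ln_mult_pos) auto
      \<comment> \<open>Both factors are at least 1, so their logarithms are nonnegative and lie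
        where \<open>a\<close> is additive.\<close>
      also have "a \<dots> = a (ln (\<alpha> * s + 1)) \<oplus> a (ln (\<alpha> * t + 1))"
        using add nonneg by (auto simp: additive_fun_def)
      also have "\<dots> = f s \<oplus> f t"
        using eq st by simp
      finally show "f (s + g s * t) = f s \<oplus> f t" .
    qed
  qed
qed

end
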